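(* Let $K$ be a field, $f\in K[Z]$ monic, irreducible and separable of degree $n$, $x_1,\dots,x_n$ a numbering of its zeros in the splitting field $L=K(x_1,\dots,x_n)$, and $G$ the Galois group of $L|K$. Put $K_i=K(x_1,\dots,x_i)$ ($K_0=K$), and let $d_i$ be the degree of the minimal polynomial of $x_i$ over $K_{i-1}$. Fix $i\in\{1,\dots,n\}$. Then there is exactly one polynomial in $L[T_1,\dots,T_i]$ of the form $$T_i^{d_i}+\sum_{k_1=1}^{d_1}\cdots\sum_{k_i=1}^{d_i} c_{k_1,\dots,k_i}\,T_1^{d_1-k_1}\cdots T_{i-1}^{d_{i-1}-k_{i-1}}T_i^{d_i-k_i}\qquad (c_{k_1,\dots,k_i}\in L)$$ which vanishes at $(\sigma(x_1),\dots,\sigma(x_i))$ for every $\sigma\in G$. Moreover, all coefficients $c_{k_1,\dots,k_i}$ of this polynomial lie in $K$.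
   Context: $T_1,\dots,T_n$ are indeterminates. *)

theory Defs
  imports
    "HOL-Algebra.Bij"
    "HOL-Algebra.Finite_Extensions"
    "HOL-Algebra.Generated_Fields"
    "HOL-Algebra.Indexed_Polynomials"
begin

definition splitting_field :: "('a, 'b) ring_scheme \<Rightarrow> 'a set \<Rightarrow> 'a list \<Rightarrow> bool"
  where "splitting_field L K f \<longleftrightarrow>
    field L \<and> subfield K L \<and> f \<in> carrier (K[X]\<^bsub>L\<^esub>) \<and> ring.splitted L f \<and>
    carrier L = generate_field L (K \<union> {a. ring.is_root L f a})"

text \<open>Separability means that all zeros in a splitting field are simple; hence this predicate
  expresses separability of \<open>f\<close> only for an \<open>L\<close> over which \<open>f\<close> splits.\<close>

definition separable_in :: "('a, 'b) ring_scheme \<Rightarrow> 'a list \<Rightarrow> bool"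
  where "separable_in L f \<longleftrightarrow> (\<forall>a. ring.is_root L f a \<longrightarrow> ring.alg_mult L f a = 1)"

text \<open>As for \<open>AutoGroup\<close>, automorphisms are extensional functions on the carrier.\<close>

definition galois_group :: "('a, 'b) ring_scheme \<Rightarrow> 'a set \<Rightarrow> ('a \<Rightarrow> 'a) monoid"
  where "galois_group L K = BijGroup (carrier L)
    \<lparr>carrier := {\<sigma> \<in> ring_iso L L \<inter> extensional (carrier L). \<forall>a\<in>K. \<sigma> a = a}\<rparr>"

definition adjoin_upto :: "('a, 'b) ring_scheme \<Rightarrow> 'a set \<Rightarrow> (nat \<Rightarrow> 'a) \<Rightarrow> nat \<Rightarrow> 'a set"
  where "adjoin_upto L K x i = generate_field L (K \<union> x ` {1..i})"

definition adjoin_degree :: "('a, 'b) ring_scheme \<Rightarrow> 'a set \<Rightarrow> (nat \<Rightarrow> 'a) \<Rightarrow> nat \<Rightarrow> nat"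
  where "adjoin_degree L K x i = degree (ring.Irr L (adjoin_upto L K x (i - 1)) (x i))"

definition (in ring) indexed_monom :: "'a \<Rightarrow> 'c multiset \<Rightarrow> ('c multiset \<Rightarrow> 'a)"
  where "indexed_monom a m = (\<lambda>m'. if m' = m then a else \<zero>)"

definition (in ring) indexed_point_eval :: "('c \<Rightarrow> 'a) \<Rightarrow> ('c multiset \<Rightarrow> 'a) \<Rightarrow> 'a"
  where "indexed_point_eval a P =
    (\<Oplus>m\<in>{m. P m \<noteq> \<zero>}. P m \<otimes> (\<Otimes>j\<in>set_mset m. a j [^] count m j))"

definition exponent_range :: "(nat \<Rightarrow> nat) \<Rightarrow> nat \<Rightarrow> (nat \<Rightarrow> nat) set"
  where "exponent_range d i = (\<Pi>\<^sub>E j\<in>{1..i}. {1..d j})"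

text \<open>The polynomial
  \<open>T\<^sub>i^(d i) + (\<Sum>k. c k * T\<^sub>1^(d 1 - k 1) * \<dots> * T\<^sub>i^(d i - k i))\<close>,
  where a tuple \<open>(k\<^sub>1, \<dots>, k\<^sub>i)\<close> is a function \<open>k\<close>.
  The outer sum is taken coefficientwise.\<close>

definition (in ring) cauchy_form ::
    "(nat \<Rightarrow> nat) \<Rightarrow> nat \<Rightarrow> ((nat \<Rightarrow> nat) \<Rightarrow> 'a) \<Rightarrow> (nat multiset \<Rightarrow> 'a)"
  where "cauchy_form d i c =
    indexed_padd
      (indexed_monom \<one> (replicate_mset (d i) i))
      (\<lambda>m. \<Oplus>k\<in>exponent_range d i.
        indexed_monom (c k) (\<Sum>j\<in>{1..i}. replicate_mset (d j - k j) j) m)"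

lemma (in ring) carrier_galois_group:
  "\<sigma> \<in> carrier (galois_group R K) \<longleftrightarrow>
    \<sigma> \<in> ring_iso R R \<and> \<sigma> \<in> extensional (carrier R) \<and> (\<forall>a\<in>K. \<sigma> a = a)"
  by (auto simp: galois_group_def)

lemma (in ring) group_galois_group:
  assumes "K \<subseteq> carrier R"
  shows "group (galois_group R K)"
proof -
  let ?A = "{\<sigma> \<in> ring_iso R R \<inter> extensional (carrier R). \<forall>a\<in>K. \<sigma> a = a}"
  have "subgroup ?A (BijGroup (carrier R))"
  proof (rule subgroup.intro)
    show "?A \<subseteq> carrier (BijGroup (carrier R))"
      by (auto simp: BijGroup_def Bij_def ring_iso_def)
  next
    fix \<sigma> \<tau> assume s: "\<sigma> \<in> ?A" and t: "\<tau> \<in> ?A"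
    then have B: "\<sigma> \<in> Bij (carrier R)" "\<tau> \<in> Bij (carrier R)"
      by (auto simp: Bij_def ring_iso_def)
    from s t have h: "\<sigma> \<in> ring_hom R R" "\<tau> \<in> ring_hom R R"
      by (auto simp: ring_iso_def)
    have "compose (carrier R) \<sigma> \<tau> \<in> ring_hom R R"
      using h by (intro ring_hom_memI) (auto simp: compose_def ring_hom_def Pi_iff)
    moreover have "compose (carrier R) \<sigma> \<tau> \<in> Bij (carrier R)"
      using B by (rule compose_Bij)
    moreover have "compose (carrier R) \<sigma> \<tau> a = a" if "a \<in> K" for a
      using that assms s t by (auto simp: compose_def)
    ultimately show "\<sigma> \<otimes>\<^bsub>BijGroup (carrier R)\<^esub> \<tau> \<in> ?A"
      using B by (auto simp: BijGroup_def Bij_def ring_iso_def)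
  next
    have "(\<lambda>x\<in>carrier R. x) \<in> ring_iso R R"
      by (intro ring_iso_memI) (auto simp: bij_betw_def inj_on_def)
    then show "\<one>\<^bsub>BijGroup (carrier R)\<^esub> \<in> ?A"
      using assms by (auto simp: BijGroup_def)
  next
    fix \<sigma> assume s: "\<sigma> \<in> ?A"
    then have B: "\<sigma> \<in> Bij (carrier R)" by (auto simp: Bij_def ring_iso_def)
    let ?t = "restrict (inv_into (carrier R) \<sigma>) (carrier R)"
    have "inv_into (carrier R) \<sigma> \<in> ring_iso R R"
      using s ring_iso_set_sym[OF ring_axioms, of \<sigma> R] by auto
    then have "?t \<in> ring_iso R R"
      by (auto simp: ring_iso_def ring_hom_def cong: bij_betw_cong)
    moreover have "?t a = a" if "a \<in> K" for a
    proof -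
      have "a \<in> carrier R" "\<sigma> a = a" using that assms s by auto
      moreover have "inj_on \<sigma> (carrier R)" using B by (auto simp: Bij_def bij_betw_def)
      ultimately show ?thesis by (metis inv_into_f_f restrict_apply')
    qed
    ultimately show "inv\<^bsub>BijGroup (carrier R)\<^esub> \<sigma> \<in> ?A"
      using B by (auto simp: inv_BijGroup)
  qed
  then show ?thesis
    unfolding galois_group_def
    by (rule subgroup.subgroup_is_group) (rule group_BijGroup)
qed

end

theory Submission
  imports Defs
begin

text \<open>
  Write \<open>K\<^sub>i = K(x\<^sub>1, \<dots>, x\<^sub>i)\<close>. The products \<open>x\<^sub>1^e\<^sub>1 \<cdots> x\<^sub>i^e\<^sub>i\<close> with \<open>e\<^sub>j < d\<^sub>j\<close> span \<open>K\<^sub>i\<close>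
  over \<open>K\<close>. Expressing \<open>-x\<^sub>i^d\<^sub>i\<close> through them gives a polynomial of the required form with
  coefficients in \<open>K\<close> that vanishes at \<open>(x\<^sub>1, \<dots>, x\<^sub>i)\<close>, hence at all its conjugates. So both claims
  follow once there is at most one such polynomial over \<open>L\<close>.

  The difference of two of them has degree less than \<open>d\<^sub>j\<close> in each \<open>T\<^sub>j\<close>. Fix \<open>\<sigma> \<in> G\<close>, substitute
  \<open>\<sigma>(x\<^sub>1), \<dots>, \<sigma>(x\<^sub>i\<^sub>-\<^sub>1)\<close>, and view it as a polynomial in \<open>T\<^sub>i\<close>. It vanishes at \<open>\<sigma>(\<tau>(x\<^sub>i))\<close> for every
  \<open>\<tau> \<in> G\<close> fixing \<open>K\<^sub>i\<^sub>-\<^sub>1\<close>. These are \<open>d\<^sub>i\<close> distinct points: the minimal polynomial of \<open>x\<^sub>i\<close> divides the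
  separable split polynomial \<open>f\<close>, and each of its zeros is some \<open>\<tau>(x\<^sub>i)\<close>. Hence all its coefficients
  vanish, for every \<open>\<sigma>\<close>, and induction on \<open>i\<close> applies to them.
\<close>

section \<open>Extending homomorphisms to simple extensions\<close>

lemma (in field) card_zeros_le_degree:
  assumes "p \<in> carrier (poly_ring R)" "p \<noteq> []"
  shows "finite {y \<in> carrier R. eval p y = \<zero>}" "card {y \<in> carrier R. eval p y = \<zero>} \<le> degree p"
proof -
  have eq: "{y \<in> carrier R. eval p y = \<zero>} = set_mset (roots p)"
    using roots_mem_iff_is_root[OF assms(1)] assms(2) by (auto simp: is_root_def)
  show "finite {y \<in> carrier R. eval p y = \<zero>}"
    unfolding eq by simp
  have "card (set_mset (roots p)) \<le> size (roots p)"
    unfolding size_multiset_overloaded_eq card_eq_sum by (rule sum_mono) (simp add: Suc_leI)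
  then show "card {y \<in> carrier R. eval p y = \<zero>} \<le> degree p"
    unfolding eq using size_roots_le_degree[OF assms(1)] by simp
qed

text \<open>The sum and product laws for \<open>map h\<close> are available up to
  \<open>normalize\<close>, which suffices because evaluation ignores leading zeros.\<close>

lemma (in field) eval_map_ring_hom:
  assumes F: "subfield F R" and h: "h \<in> ring_hom (R\<lparr>carrier := F\<rparr>) R" and y: "y \<in> carrier R"
  shows "(\<lambda>p. eval (map h p) y) \<in> ring_hom (F[X]) R"
proof -
  have sub: "subring F R" using subfieldE(1)[OF F] .
  interpret F: ring "R\<lparr>carrier := F\<rparr>" using subring_is_ring[OF sub] .
  interpret h: ring_hom_ring "R\<lparr>carrier := F\<rparr>" R h
    by (intro ring_hom_ringI2 h F.ring_axioms ring_axioms)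
  have incl: "set p \<subseteq> F" if "p \<in> carrier (F[X])" for p
    using that polynomial_incl univ_poly_carrier by blast
  have hincl: "set (map h p) \<subseteq> carrier R" if "set p \<subseteq> F" for p
    using that h.hom_closed by auto
  show ?thesis
  proof (rule ring_hom_memI)
    fix p assume "p \<in> carrier (F[X])"
    then show "eval (map h p) y \<in> carrier R"
      using eval_in_carrier[OF hincl y] incl by blast
  next
    fix p q assume p: "p \<in> carrier (F[X])" and q: "q \<in> carrier (F[X])"
    note pq = incl[OF p] incl[OF q]
    have "set (poly_mult p q) \<subseteq> F"
      using F.poly_mult_in_carrier[of p q] pq poly_mult_consistent[OF sub] by simp
    then have "eval (map h (poly_mult p q)) y = eval (normalize (map h (poly_mult p q))) y"
      using eval_normalize[OF hincl y] by simp
    also have "\<dots> = eval (poly_mult (map h p) (map h q)) y"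
      using h.poly_mult_hom'[of p q] pq poly_mult_consistent[OF sub] by simp
    also have "\<dots> = eval (map h p) y \<otimes> eval (map h q) y"
      using eval_poly_mult[OF hincl hincl y] pq by blast
    finally show "eval (map h (p \<otimes>\<^bsub>F[X]\<^esub> q)) y = eval (map h p) y \<otimes> eval (map h q) y"
      by (simp add: univ_poly_mult)
    have "set (poly_add p q) \<subseteq> F"
      using F.poly_add_in_carrier[of p q] pq poly_add_consistent[OF sub]
      by (simp del: poly_add.simps F.poly_add.simps)
    then have "eval (map h (poly_add p q)) y = eval (normalize (map h (poly_add p q))) y"
      using eval_normalize[OF hincl y] by (simp del: poly_add.simps)
    also have "\<dots> = eval (poly_add (map h p) (map h q)) y"
      using h.poly_add_hom'[of p q] pq poly_add_consistent[OF sub]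
      by (simp del: poly_add.simps F.poly_add.simps)
    also have "\<dots> = eval (map h p) y \<oplus> eval (map h q) y"
      using eval_poly_add[OF hincl hincl y] pq by blast
    finally show "eval (map h (p \<oplus>\<^bsub>F[X]\<^esub> q)) y = eval (map h p) y \<oplus> eval (map h q) y"
      by (simp add: univ_poly_add)
  next
    show "eval (map h \<one>\<^bsub>F[X]\<^esub>) y = \<one>"
      using h.hom_one by (simp add: univ_poly_one)
  qed
qed

text \<open>Every element of F(a) is a value \<open>eval p a\<close>; it is sent to
  \<open>eval (map h p) y\<close>. This does not depend on \<open>p\<close>: a polynomial vanishing
  at \<open>a\<close> is a multiple of \<open>Irr F a\<close>, and \<open>y\<close> is a zero of the
  image of \<open>Irr F a\<close>.\<close>

lemma (in field) ring_hom_extends_to_simple_extension: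
  assumes F: "subfield F R" and h: "h \<in> ring_hom (R\<lparr>carrier := F\<rparr>) R"
    and a: "a \<in> carrier R" "(algebraic over F) a"
    and y: "y \<in> carrier R" "eval (map h (Irr F a)) y = \<zero>"
  obtains g where "g \<in> ring_hom (R\<lparr>carrier := simple_extension F a\<rparr>) R"
    "\<And>b. b \<in> F \<Longrightarrow> g b = h b" "g a = y"
proof -
  have sub: "subring F R" using subfieldE(1)[OF F] .
  interpret F: ring "R\<lparr>carrier := F\<rparr>" using subring_is_ring[OF sub] .
  interpret h: ring_hom_ring "R\<lparr>carrier := F\<rparr>" R h
    by (intro ring_hom_ringI2 h F.ring_axioms ring_axioms)
  interpret UP: domain "F[X]" using univ_poly_is_domain[OF sub] .
  interpret E: ring_hom_ring "F[X]" R "\<lambda>p. eval p a" using eval_ring_hom[OF sub a(1)] .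
  interpret Y: ring_hom_ring "F[X]" R "\<lambda>p. eval (map h p) y"
    by (intro ring_hom_ringI2 eval_map_ring_hom F h y UP.ring_axioms ring_axioms)
  note irr = IrrE[OF F a]
  have ker: "eval (map h p) y = \<zero>" if p: "p \<in> carrier (F[X])" "eval p a = \<zero>" for p
  proof -
    have "Irr F a divides\<^bsub>F[X]\<^esub> p"
      using Irr_minimal[OF F a p] pdivides_iff_shell[OF F irr(1) p(1)] by simp
    then obtain q where q: "q \<in> carrier (F[X])" "p = Irr F a \<otimes>\<^bsub>F[X]\<^esub> q" by (auto simp: factor_def)
    show ?thesis
      unfolding q(2) using Y.hom_mult[OF irr(1) q(1)] y(2) Y.hom_closed[OF q(1)] by simp
  qed
  have well_defined: "eval (map h p) y = eval (map h q) y"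
    if p: "p \<in> carrier (F[X])" and q: "q \<in> carrier (F[X])" and eq: "eval p a = eval q a" for p q
  proof -
    have "eval (p \<ominus>\<^bsub>F[X]\<^esub> q) a = \<zero>"
      using p q eq by (simp add: UP.minus_eq r_neg)
    then have "eval (map h (p \<ominus>\<^bsub>F[X]\<^esub> q)) y = \<zero>"
      using ker p q by simp
    then show ?thesis
      using p q by (simp add: UP.minus_eq minus_eq[symmetric])
  qed
  \<comment> \<open>The choice of a representing polynomial is arbitrary;
    \<open>well_defined\<close> makes it harmless.\<close>
  define g where "g b = eval (map h (SOME p. p \<in> carrier (F[X]) \<and> eval p a = b)) y" for b
  have g: "g (eval p a) = eval (map h p) y" if "p \<in> carrier (F[X])" for p
  proof -
    let ?q = "SOME q. q \<in> carrier (F[X]) \<and> eval q a = eval p a"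
    have "?q \<in> carrier (F[X]) \<and> eval ?q a = eval p a"
      by (rule someI[of _ p]) (use that in simp)
    then show ?thesis unfolding g_def using well_defined that by blast
  qed
  have img: "simple_extension F a = (\<lambda>p. eval p a) ` carrier (F[X])"
    using simple_extension_as_eval_img[OF subringE(1)[OF sub] a(1)] .
  have "g \<in> ring_hom (R\<lparr>carrier := simple_extension F a\<rparr>) R"
  proof (rule ring_hom_memI; clarsimp simp: img)
    fix p assume p: "p \<in> carrier (F[X])"
    then show "g (eval p a) \<in> carrier R" using g Y.hom_closed by simp
    fix q assume q: "q \<in> carrier (F[X])"
    show "g (eval p a \<otimes> eval q a) = g (eval p a) \<otimes> g (eval q a)"
      using g[OF UP.m_closed[OF p q]] g[OF p] g[OF q] p q by simp
    show "g (eval p a \<oplus> eval q a) = g (eval p a) \<oplus> g (eval q a)"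
      using g[OF UP.a_closed[OF p q]] g[OF p] g[OF q] p q by simp
  next
    show "g \<one> = \<one>" using g[OF UP.one_closed] by simp
  qed
  \<comment> \<open>Zero is treated apart: as a constant polynomial it is \<open>[]\<close>, whereas
    \<open>[b]\<close> is in normal form only for nonzero \<open>b\<close>.\<close>
  moreover have "g b = h b" if b: "b \<in> F" for b
  proof (cases "b = \<zero>")
    case True
    then show ?thesis using g[OF UP.zero_closed] h.hom_zero by (simp add: univ_poly_zero)
  next
    case False
    have "b \<in> carrier R" using b subringE(1)[OF sub] by auto
    moreover have "[b] \<in> carrier (F[X])"
      using b False by (simp add: univ_poly_carrier[symmetric] polynomial_def)
    moreover have "h b \<in> carrier R" using h.hom_closed b by simp
    ultimately show ?thesis using g[of "[b]"] by simp
  qed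
  moreover have "g a = y"
    using g[OF var_closed(1)[OF sub]] a y h.hom_one h.hom_zero by (simp add: var_def)
  ultimately show thesis using that by blast
qed

text \<open>Write f = p q. As \<open>h\<close> fixes f, every zero of f is a zero of the image of p
  or of q. The image of q has at most \<open>degree q\<close> zeros, so at least
  \<open>degree f - degree q\<close> are left for the image of p.\<close>

lemma (in field) card_zeros_map_ge_degree:
  assumes F: "subfield F R" and h: "h \<in> ring_hom (R\<lparr>carrier := F\<rparr>) R"
    and f: "f \<in> carrier (F[X])" "f \<noteq> []" "map h f = f" "degree f \<le> card {y. is_root f y}"
    and p: "p \<in> carrier (F[X])" "p pdivides f"
  shows "degree p \<le> card {y \<in> carrier R. eval (map h p) y = \<zero>}"
proof -
  have sub: "subring F R" using subfieldE(1)[OF F] .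
  interpret F: field "R\<lparr>carrier := F\<rparr>" using subfield_iff(2)[OF F] .
  interpret h: ring_hom_ring "R\<lparr>carrier := F\<rparr>" R h
    by (intro ring_hom_ringI2 h F.ring_axioms ring_axioms)
  interpret UP: domain "F[X]" using univ_poly_is_domain[OF sub] .
  obtain q where q: "q \<in> carrier (F[X])" "f = p \<otimes>\<^bsub>F[X]\<^esub> q"
    using p(2) pdivides_iff_shell[OF F p(1) f(1)] by (auto simp: factor_def)
  have ne: "p \<noteq> []" "q \<noteq> []"
    using f(2) p(1) q UP.l_null UP.r_null by (auto simp: univ_poly_zero)
  have deg: "degree f = degree p + degree q"
    using q p ne poly_mult_degree_eq[OF sub, of p q] by (simp add: univ_poly_mult univ_poly_carrier)
  \<comment> \<open>A homomorphism of fields is injective, so the leading coefficient stays nonzero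
    and \<open>map h r\<close> is a genuine polynomial, to which the bound on zeros applies.\<close>
  have map_poly: "map h r \<in> carrier (poly_ring R)" if "r \<in> carrier (F[X])" for r
  proof -
    have inj: "inj_on h F"
      using non_trivial_field_hom_is_inj[OF h F.field_axioms field_axioms] by simp
    have "set r \<subseteq> F" using that polynomial_incl univ_poly_carrier by blast
    moreover have "h (hd r) \<noteq> \<zero>" if "r \<noteq> []"
    proof -
      have "hd r \<noteq> \<zero>" using \<open>r \<in> carrier (F[X])\<close> that
        by (auto simp: univ_poly_carrier[symmetric] polynomial_def)
      moreover have "hd r \<in> F" using \<open>set r \<subseteq> F\<close> that by auto
      ultimately show ?thesis
        using inj h.hom_zero subringE(2)[OF sub] by (auto simp: inj_on_def)
    qed
    ultimately show ?thesis
      using h.hom_closed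
      by (auto simp: univ_poly_carrier[symmetric] polynomial_def hd_map)
  qed
  let ?Z = "\<lambda>r. {y \<in> carrier R. eval (map h r) y = \<zero>}"
  have "{y. is_root f y} \<subseteq> ?Z p \<union> ?Z q"
  proof
    fix y assume "y \<in> {y. is_root f y}"
    then have y: "y \<in> carrier R" "eval (map h f) y = \<zero>"
      using f(3) by (auto simp: is_root_def)
    interpret Y: ring_hom_ring "F[X]" R "\<lambda>p. eval (map h p) y"
      by (intro ring_hom_ringI2 eval_map_ring_hom F h y UP.ring_axioms ring_axioms)
    show "y \<in> ?Z p \<union> ?Z q"
      using y q p(1) Y.hom_mult[OF p(1) q(1)] integral_iff Y.hom_closed by auto
  qed
  moreover have "finite (?Z p)" "finite (?Z q)" "card (?Z q) \<le> degree q"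
    using card_zeros_le_degree[OF map_poly[OF p(1)]] card_zeros_le_degree[OF map_poly[OF q(1)]] ne
    by auto
  ultimately have "card {y. is_root f y} \<le> card (?Z p) + degree q"
    by (meson add_left_mono card_Un_le card_mono dual_order.trans finite_UnI)
  with f(4) deg show ?thesis by linarith
qed

section \<open>Sums over exponent tuples\<close>

lemma finite_exponent_range: "finite (exponent_range d i)"
  by (simp add: exponent_range_def finite_PiE)

lemma exponent_range_0: "exponent_range d 0 = {\<lambda>_. undefined}"
  by (simp add: exponent_range_def)

lemma exponent_range_Suc:
  "exponent_range d (Suc i) = (\<Union>e\<in>{1..d (Suc i)}. (\<lambda>k. k(Suc i := e)) ` exponent_range d i)"
proof -
  have "exponent_range d (Suc i)
      = (\<lambda>(e, k). k(Suc i := e)) ` ({1..d (Suc i)} \<times> exponent_range d i)"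
    by (simp only: exponent_range_def atLeastAtMostSuc_conv[of 1 i] PiE_insert_eq
        le_add1 plus_1_eq_Suc)
  then show ?thesis by auto
qed

text \<open>Tuples in \<open>exponent_range d i\<close> all take the value \<open>undefined\<close>
  at \<open>Suc i\<close>, so overwriting that position loses nothing.\<close>

lemma inj_on_exponent_range_upd: "inj_on (\<lambda>k. k(Suc i := e)) (exponent_range d i)"
proof (rule inj_onI)
  fix k l assume k: "k \<in> exponent_range d i" and l: "l \<in> exponent_range d i"
    and eq: "k(Suc i := e) = l(Suc i := e)"
  have "k (Suc i) = l (Suc i)"
    using k l by (auto simp: exponent_range_def PiE_def extensional_def)
  then show "k = l" using eq by (metis fun_upd_triv fun_upd_upd)
qed

lemma (in ring) finsum_exponent_range_Suc:
  assumes "g \<in> exponent_range d (Suc i) \<rightarrow> carrier R"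
  shows "finsum R g (exponent_range d (Suc i))
    = (\<Oplus>e\<in>{1..d (Suc i)}. \<Oplus>k\<in>exponent_range d i. g (k(Suc i := e)))"
proof -
  let ?A = "\<lambda>e. (\<lambda>k. k(Suc i := e)) ` exponent_range d i"
  have disj: "pairwise (\<lambda>e e'. disjnt (?A e) (?A e')) {1..d (Suc i)}"
    by (auto simp: pairwise_def disjnt_def) (metis fun_upd_same)
  have mem: "g y \<in> carrier R" if "e \<in> {1..d (Suc i)}" "y \<in> ?A e" for e y
    using assms that by (auto simp: exponent_range_Suc Pi_iff)
  have "finsum R g (exponent_range d (Suc i)) = (\<Oplus>e\<in>{1..d (Suc i)}. finsum R g (?A e))"
    unfolding exponent_range_Suc
    by (rule add.finprod_UN_disjoint) (use disj mem in \<open>auto simp: finite_exponent_range\<close>)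
  also have "\<dots> = (\<Oplus>e\<in>{1..d (Suc i)}. \<Oplus>k\<in>exponent_range d i. g (k(Suc i := e)))"
  proof (rule add.finprod_cong')
    fix e assume e: "e \<in> {1..d (Suc i)}"
    show "finsum R g (?A e) = (\<Oplus>k\<in>exponent_range d i. g (k(Suc i := e)))"
      by (rule add.finprod_reindex) (use mem[OF e] inj_on_exponent_range_upd in auto)
  qed (use mem in \<open>auto intro!: finsum_closed\<close>)
  finally show ?thesis .
qed

text \<open>The value at \<open>a\<close> of the monomial that carries the coefficient
  \<open>c k\<close> in \<open>cauchy_form d i c\<close>.\<close>

definition (in ring) power_prod :: "(nat \<Rightarrow> nat) \<Rightarrow> (nat \<Rightarrow> 'a) \<Rightarrow> nat \<Rightarrow> (nat \<Rightarrow> nat) \<Rightarrow> 'a"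
  where "power_prod d a i k = (\<Otimes>j\<in>{1..i}. a j [^] (d j - k j))"

lemma (in cring) power_prod_closed:
  assumes "a \<in> {1..i} \<rightarrow> carrier R"
  shows "power_prod d a i k \<in> carrier R"
  unfolding power_prod_def using assms by (intro finprod_closed) auto

lemma (in cring) power_prod_Suc:
  assumes "a \<in> {1..Suc i} \<rightarrow> carrier R"
  shows "power_prod d a (Suc i) (k(Suc i := e))
    = power_prod d a i k \<otimes> a (Suc i) [^] (d (Suc i) - e)"
proof -
  have eq: "{1..Suc i} = insert (Suc i) {1..i}" by auto
  have "power_prod d a (Suc i) (k(Suc i := e))
      = a (Suc i) [^] (d (Suc i) - e) \<otimes> (\<Otimes>j\<in>{1..i}. a j [^] (d j - (k(Suc i := e)) j))"
    unfolding power_prod_def eq using assms by (subst finprod_insert) auto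
  also have "(\<Otimes>j\<in>{1..i}. a j [^] (d j - (k(Suc i := e)) j)) = power_prod d a i k"
    unfolding power_prod_def using assms by (intro finprod_cong') auto
  finally show ?thesis
    using assms by (simp only:) (intro m_comm power_prod_closed nat_pow_closed, auto)
qed

text \<open>Recursive view for the inductions on \<open>i\<close>: the sum is the value of a
  polynomial in the last variable of degree below \<open>d (Suc i)\<close>, with sums over shorter
  tuples as coefficients.\<close>

lemma (in cring) finsum_power_prod_Suc:
  assumes a: "a \<in> {1..Suc i} \<rightarrow> carrier R" and c: "c \<in> exponent_range d (Suc i) \<rightarrow> carrier R"
  shows "(\<Oplus>k\<in>exponent_range d (Suc i). c k \<otimes> power_prod d a (Suc i) k)
    = (\<Oplus>e\<in>{1..d (Suc i)}.
        (\<Oplus>k\<in>exponent_range d i. c (k(Suc i := e)) \<otimes> power_prod d a i k)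
          \<otimes> a (Suc i) [^] (d (Suc i) - e))"
proof -
  have a': "a \<in> {1..i} \<rightarrow> carrier R" "a (Suc i) \<in> carrier R" using a by auto
  have c': "c (k(Suc i := e)) \<in> carrier R"
    if "e \<in> {1..d (Suc i)}" "k \<in> exponent_range d i" for e k
    using c that by (auto simp: exponent_range_Suc Pi_iff)
  have "(\<Oplus>k\<in>exponent_range d (Suc i). c k \<otimes> power_prod d a (Suc i) k)
    = (\<Oplus>e\<in>{1..d (Suc i)}. \<Oplus>k\<in>exponent_range d i.
        c (k(Suc i := e)) \<otimes> power_prod d a (Suc i) (k(Suc i := e)))"
    using c power_prod_closed[OF a] by (intro finsum_exponent_range_Suc) auto
  also have "\<dots> = (\<Oplus>e\<in>{1..d (Suc i)}.
        (\<Oplus>k\<in>exponent_range d i. c (k(Suc i := e)) \<otimes> power_prod d a i k)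
          \<otimes> a (Suc i) [^] (d (Suc i) - e))"
  proof (rule add.finprod_cong')
    fix e assume e: "e \<in> {1..d (Suc i)}"
    have "(\<Oplus>k\<in>exponent_range d i. c (k(Suc i := e)) \<otimes> power_prod d a (Suc i) (k(Suc i := e)))
      = (\<Oplus>k\<in>exponent_range d i.
          c (k(Suc i := e)) \<otimes> power_prod d a i k \<otimes> a (Suc i) [^] (d (Suc i) - e))"
      using c'[OF e] power_prod_closed[OF a'(1)] a'(2)
      by (intro add.finprod_cong') (auto simp: power_prod_Suc[OF a] m_assoc)
    also have "\<dots> = (\<Oplus>k\<in>exponent_range d i. c (k(Suc i := e)) \<otimes> power_prod d a i k)
        \<otimes> a (Suc i) [^] (d (Suc i) - e)"
      using c'[OF e] power_prod_closed[OF a'(1)] a'(2)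
      by (intro finsum_ldistr[symmetric]) (auto simp: finite_exponent_range)
    finally show "(\<Oplus>k\<in>exponent_range d i.
        c (k(Suc i := e)) \<otimes> power_prod d a (Suc i) (k(Suc i := e))) = \<dots>" .
  qed (use c' power_prod_closed[OF a'(1)] a'(2) in \<open>auto intro!: finsum_closed m_closed\<close>)
  finally show ?thesis .
qed

text \<open>Coefficient lists start with the leading coefficient, so entry \<open>e\<close> of
  \<open>D\<close> belongs to the power \<open>D - e\<close>. Appending one entry is a Horner step:
  multiply by \<open>y\<close> and add.\<close>

lemma (in ring) eval_map_upt:
  assumes "b \<in> {1..D} \<rightarrow> carrier R" "y \<in> carrier R"
  shows "eval (map b [1..<Suc D]) y = (\<Oplus>e\<in>{1..D}. b e \<otimes> y [^] (D - e))"
  using assms(1)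
proof (induct D)
  case 0
  then show ?case by simp
next
  case (Suc D)
  have eq: "{1..Suc D} = insert (Suc D) {1..D}" by auto
  have b: "b \<in> {1..D} \<rightarrow> carrier R" "b (Suc D) \<in> carrier R" using Suc.prems by auto
  have "eval (map b [1..<Suc (Suc D)]) y = eval (map b [1..<Suc D]) y \<otimes> y \<oplus> b (Suc D)"
  proof -
    have "set (map b [1..<Suc D]) \<subseteq> carrier R" using b(1) by auto
    from eval_append_aux[OF this b(2) assms(2)] show ?thesis by simp
  qed
  also have "\<dots> = (\<Oplus>e\<in>{1..D}. b e \<otimes> y [^] (D - e)) \<otimes> y \<oplus> b (Suc D)"
    using Suc.hyps[OF b(1)] by simp
  also have "(\<Oplus>e\<in>{1..D}. b e \<otimes> y [^] (D - e)) \<otimes> y = (\<Oplus>e\<in>{1..D}. b e \<otimes> y [^] (D - e) \<otimes> y)"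
    using b assms(2) by (intro finsum_ldistr) auto
  also have "\<dots> = (\<Oplus>e\<in>{1..D}. b e \<otimes> y [^] (Suc D - e))"
    using b assms(2) by (intro add.finprod_cong') (auto simp: m_assoc Suc_diff_le Pi_iff)
  also have "\<dots> \<oplus> b (Suc D) = b (Suc D) \<oplus> (\<Oplus>e\<in>{1..D}. b e \<otimes> y [^] (Suc D - e))"
    using b assms(2) by (intro a_comm finsum_closed) auto
  also have "\<dots> = (\<Oplus>e\<in>{1..Suc D}. b e \<otimes> y [^] (Suc D - e))"
    unfolding eq using b assms(2) by (subst add.finprod_insert) auto
  finally show ?case .
qed

text \<open>The \<open>b e\<close> are the coefficients of a polynomial of degree less than
  \<open>D\<close>, and such a polynomial with \<open>D\<close> distinct zeros vanishes. Leading
  entries may be zero, hence the passage to \<open>normalize\<close>.\<close>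

lemma (in field) coeffs_eq_zero_if_many_zeros:
  assumes b: "b \<in> {1..D} \<rightarrow> carrier R" and Y: "Y \<subseteq> carrier R" "D \<le> card Y"
    and zero: "\<And>y. y \<in> Y \<Longrightarrow> (\<Oplus>e\<in>{1..D}. b e \<otimes> y [^] (D - e)) = \<zero>"
    and e: "e \<in> {1..D}"
  shows "b e = \<zero>"
proof -
  let ?p = "map b [1..<Suc D]"
  have p: "set ?p \<subseteq> carrier R" using b by (auto simp: Pi_iff)
  have Z: "Y \<subseteq> {y \<in> carrier R. eval (normalize ?p) y = \<zero>}"
    using Y(1) zero eval_map_upt[OF b] eval_normalize[OF p] by auto
  have "normalize ?p = []"
  proof (rule ccontr)
    assume ne: "normalize ?p \<noteq> []"
    have "normalize ?p \<in> carrier (poly_ring R)"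
      using normalize_gives_polynomial[OF p] by (simp only: univ_poly_carrier)
    note le = card_zeros_le_degree[OF this ne]
    have "card Y \<le> degree (normalize ?p)"
      using card_mono[OF le(1) Z] le(2) by linarith
    moreover have "length (normalize ?p) \<le> D"
      using normalize_length_le[of ?p] by (simp del: upt_Suc)
    moreover have "length (normalize ?p) > 0" using ne by simp
    ultimately show False using Y(2) by linarith
  qed
  \<comment> \<open>\<open>normalize\<close> strips only leading zeros, so an empty result means
    that the list consists of zeros.\<close>
  then have "?p = replicate (length ?p) \<zero>"
    using normalize_def'[of ?p] by simp
  then have "set ?p \<subseteq> {\<zero>}"
    by (metis insert_iff set_replicate_conv_if empty_iff subsetI singletonD)
  moreover have "b e \<in> set ?p" using e by (auto simp del: upt_Suc)
  ultimately show ?thesis by blast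
qed

section \<open>Evaluation of the normal form\<close>

text \<open>Terms outside the support vanish. This replaces the support, which depends on which
  coefficients happen to be zero, by a fixed index set.\<close>

lemma (in ring) indexed_point_eval_superset:
  assumes A: "finite A" "{m. P m \<noteq> \<zero>} \<subseteq> A" and P: "\<And>m. P m \<in> carrier R"
    and mon: "\<And>m. m \<in> A \<Longrightarrow> (\<Otimes>j\<in>set_mset m. a j [^] count m j) \<in> carrier R"
  shows "indexed_point_eval a P = (\<Oplus>m\<in>A. P m \<otimes> (\<Otimes>j\<in>set_mset m. a j [^] count m j))"
  unfolding indexed_point_eval_def
  by (rule add.finprod_mono_neutral_cong_left) (use assms in auto)

lemma (in ring) indexed_monom_in_indexed_pset:
  fixes m :: "'c multiset"
  assumes "a \<in> K" "set_mset m \<subseteq> I"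
  shows "indexed_monom a m \<in> indexed_pset I K"
  using assms(2)
proof (induct m)
  case empty
  have "indexed_monom a ({#} :: 'c multiset) = indexed_const a"
    by (simp add: indexed_monom_def indexed_const_def)
  then show ?case using indexed_pset.indexed_const[OF assms(1), of I] by simp
next
  case (add j m)
  have "indexed_monom a (add_mset j m) = indexed_pmult (indexed_monom a m) j"
    by (auto simp: indexed_monom_def indexed_pmult_def fun_eq_iff)
  then show ?case using add by (auto intro: indexed_pset.indexed_pmult)
qed

lemma (in ring) finsum_in_indexed_pset:
  assumes K: "subring K R" and "finite A" "\<And>k. k \<in> A \<Longrightarrow> F k \<in> indexed_pset I K"
  shows "(\<lambda>m. \<Oplus>k\<in>A. F k m) \<in> indexed_pset I K"
  using assms(2,3)
proof (induct A)
  case empty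
  have "(\<lambda>m. \<Oplus>k\<in>{}. F k m) = indexed_const \<zero>" by (simp add: indexed_zero_def)
  then show ?case using indexed_pset.indexed_const[OF subringE(2)[OF K]] by simp
next
  case (insert k A)
  have "F l m \<in> carrier R" if "l \<in> insert k A" for l m
    using indexed_pset_in_carrier[OF subringE(1)[OF K] insert.prems[OF that]]
    by (simp add: carrier_coeff_def)
  then have "(\<lambda>m. \<Oplus>k\<in>insert k A. F k m) = indexed_padd (F k) (\<lambda>m. \<Oplus>k\<in>A. F k m)"
    using insert.hyps by (auto simp: indexed_padd_def fun_eq_iff)
  then show ?case using insert by (auto intro: indexed_pset.indexed_padd)
qed

lemma count_sum_replicate_mset:
  "count (\<Sum>j\<in>{1..i::nat}. replicate_mset (g j) j) l = (if l \<in> {1..i} then g l else 0)"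
  by (simp add: count_sum)

lemma set_mset_sum_replicate_mset:
  "set_mset (\<Sum>j\<in>{1..i::nat}. replicate_mset (g j) j) \<subseteq> {1..i}"
proof
  fix l assume "l \<in># (\<Sum>j\<in>{1..i}. replicate_mset (g j) j)"
  then have "count (\<Sum>j\<in>{1..i}. replicate_mset (g j) j) l \<noteq> 0" by simp
  then show "l \<in> {1..i}" unfolding count_sum_replicate_mset by meson
qed

text \<open>On \<open>exponent_range\<close> the entry \<open>k j\<close> is at most
  \<open>d j\<close>, so the truncated subtraction \<open>d j - k j\<close> determines
  \<open>k j\<close>.\<close>

lemma inj_on_exponent_mset:
  "inj_on (\<lambda>k. \<Sum>j\<in>{1..i}. replicate_mset (d j - k j) j) (exponent_range d i)"
proof (rule inj_onI)
  fix k l assume k: "k \<in> exponent_range d i" and l: "l \<in> exponent_range d i"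
    and eq: "(\<Sum>j\<in>{1..i}. replicate_mset (d j - k j) j) = (\<Sum>j\<in>{1..i}. replicate_mset (d j - l j) j)"
  show "k = l"
  proof (rule PiE_ext[OF k[unfolded exponent_range_def] l[unfolded exponent_range_def]])
    fix j assume j: "j \<in> {1..i}"
    have "d j - k j = d j - l j"
      using arg_cong[OF eq, of "\<lambda>m. count m j"] j by (simp only: count_sum_replicate_mset if_True)
    moreover have "k j \<in> {1..d j}" "l j \<in> {1..d j}"
      using k l j by (auto simp: exponent_range_def)
    ultimately show "k j = l j" by auto
  qed
qed

text \<open>Since \<open>k i\<close> is at least 1, T_i occurs in these monomials with exponent
  below \<open>d i\<close>.\<close>

lemma leading_mset_neq_exponent_mset:
  assumes "k \<in> exponent_range d i" "i \<ge> 1"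
  shows "(\<Sum>j\<in>{1..i}. replicate_mset (d j - k j) j) \<noteq> replicate_mset (d i) i"
proof
  assume "(\<Sum>j\<in>{1..i}. replicate_mset (d j - k j) j) = replicate_mset (d i) i"
  then have "count (\<Sum>j\<in>{1..i}. replicate_mset (d j - k j) j) i = d i" by simp
  then have "d i - k i = d i" using assms(2) by (simp only: count_sum_replicate_mset) simp
  moreover have "k i \<in> {1..d i}" using assms by (auto simp: exponent_range_def)
  ultimately show False by auto
qed

lemma (in cring) cauchy_form_in_indexed_pset:
  assumes "c \<in> exponent_range d i \<rightarrow> carrier R" "i \<ge> 1"
  shows "cauchy_form d i c \<in> indexed_pset {1..i} (carrier R)"
  unfolding cauchy_form_def using assms
  by (intro indexed_pset.indexed_padd indexed_monom_in_indexed_pset finsum_in_indexed_pset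
      set_mset_sum_replicate_mset carrier_is_subring finite_exponent_range)
    (auto split: if_splits)

text \<open>The monomials of distinct tuples are distinct and differ from the leading one, so no
  coefficients merge and the sum over multisets turns into one over tuples.\<close>

lemma (in cring) indexed_point_eval_cauchy_form:
  assumes c: "c \<in> exponent_range d i \<rightarrow> carrier R" and i: "i \<ge> 1" and a: "a \<in> {1..i} \<rightarrow> carrier R"
  shows "indexed_point_eval a (cauchy_form d i c)
    = a i [^] d i \<oplus> (\<Oplus>k\<in>exponent_range d i. c k \<otimes> power_prod d a i k)"
proof -
  let ?M = "\<lambda>k. \<Sum>j\<in>{1..i}. replicate_mset (d j - k j) j"
  let ?T = "replicate_mset (d i) i"
  let ?E = "exponent_range d i"
  let ?A = "insert ?T (?M ` ?E)"
  let ?v = "\<lambda>m. \<Otimes>j\<in>set_mset m. a j [^] count m j"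
  have v: "?v m = (\<Otimes>j\<in>{1..i}. a j [^] count m j)" if "set_mset m \<subseteq> {1..i}" for m
    by (rule finprod_mono_neutral_cong_left) (use that a in \<open>auto simp: not_in_iff\<close>)
  have vM: "?v (?M k) = power_prod d a i k" for k
    unfolding v[OF set_mset_sum_replicate_mset] power_prod_def
    by (rule finprod_cong', rule refl) (use a in auto, simp add: count_sum)
  have vT: "?v ?T = a i [^] d i"
    using a i by (cases "d i = 0") (auto simp: Pi_iff)
  have cl: "indexed_monom (c k) (?M k) m \<in> carrier R" if "k \<in> ?E" for k m
    using c that by (auto simp: indexed_monom_def)
  have form: "cauchy_form d i c m
      = indexed_monom \<one> ?T m \<oplus> (\<Oplus>k\<in>?E. indexed_monom (c k) (?M k) m)" for m
    by (simp add: cauchy_form_def indexed_padd_def)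
  \<comment> \<open>The coefficients are read off: one at the leading monomial, \<open>c k\<close>
    at the monomial of \<open>k\<close>, and zero elsewhere.\<close>
  have PT: "cauchy_form d i c ?T = \<one>"
  proof -
    have "(\<Oplus>k\<in>?E. indexed_monom (c k) (?M k) ?T) = (\<Oplus>k\<in>?E. \<zero>)"
      by (rule add.finprod_cong')
        (use leading_mset_neq_exponent_mset[OF _ i] in \<open>fastforce simp: indexed_monom_def\<close>)+
    then show ?thesis unfolding form by (simp add: indexed_monom_def)
  qed
  have PM: "cauchy_form d i c (?M k) = c k" if k: "k \<in> ?E" for k
  proof -
    have "(\<Oplus>l\<in>?E. indexed_monom (c l) (?M l) (?M k)) = (\<Oplus>l\<in>?E. if k = l then c l else \<zero>)"
    proof (rule add.finprod_cong')
      fix l assume "l \<in> ?E"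
      then show "indexed_monom (c l) (?M l) (?M k) = (if k = l then c l else \<zero>)"
        using inj_onD[OF inj_on_exponent_mset _ k, of l] by (auto simp: indexed_monom_def)
    qed (use c in auto)
    also have "\<dots> = c k"
      by (rule add.finprod_singleton[OF k finite_exponent_range]) (use c in auto)
    finally show ?thesis
      unfolding form using leading_mset_neq_exponent_mset[OF k i] c k
      by (auto simp: indexed_monom_def Pi_iff)
  qed
  have P0: "cauchy_form d i c m = \<zero>" if "m \<notin> ?A" for m
  proof -
    have "(\<Oplus>k\<in>?E. indexed_monom (c k) (?M k) m) = (\<Oplus>k\<in>?E. \<zero>)"
      by (rule add.finprod_cong') (use that in \<open>auto simp: indexed_monom_def\<close>)
    then show ?thesis unfolding form using that by (simp add: indexed_monom_def)
  qed
  have P: "cauchy_form d i c m \<in> carrier R" for m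
    unfolding form using cl by (intro a_closed finsum_closed) (auto simp: indexed_monom_def)
  have aT: "a i [^] d i \<in> carrier R" using a i by auto
  have "indexed_point_eval a (cauchy_form d i c) = (\<Oplus>m\<in>?A. cauchy_form d i c m \<otimes> ?v m)"
  proof (rule indexed_point_eval_superset)
    show "?v m \<in> carrier R" if "m \<in> ?A" for m
      using that vM vT aT power_prod_closed[OF a] by auto
  qed (use P0 P finite_exponent_range in auto)
  also have "\<dots> = cauchy_form d i c ?T \<otimes> ?v ?T \<oplus> (\<Oplus>m\<in>?M ` ?E. cauchy_form d i c m \<otimes> ?v m)"
  proof (rule add.finprod_insert)
    show "?T \<notin> ?M ` ?E" by (rule notI, erule imageE) (use leading_mset_neq_exponent_mset[OF _ i] in metis)
    show "(\<lambda>m. cauchy_form d i c m \<otimes> ?v m) \<in> ?M ` ?E \<rightarrow> carrier R"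
      using P vM power_prod_closed[OF a] by auto
    show "cauchy_form d i c ?T \<otimes> ?v ?T \<in> carrier R" unfolding vT using P aT by simp
  qed (simp add: finite_exponent_range)
  also have "(\<Oplus>m\<in>?M ` ?E. cauchy_form d i c m \<otimes> ?v m)
      = (\<Oplus>k\<in>?E. cauchy_form d i c (?M k) \<otimes> ?v (?M k))"
    by (rule add.finprod_reindex)
      (use P vM power_prod_closed[OF a] inj_on_exponent_mset in auto)
  also have "\<dots> = (\<Oplus>k\<in>?E. c k \<otimes> power_prod d a i k)"
    by (rule add.finprod_cong') (use c PM vM power_prod_closed[OF a] in auto)
  finally show ?thesis using PT vT aT by simp
qed

section \<open>The tower of root fields\<close>

text \<open>That \<open>f\<close> has as many distinct zeros as its degree encodes both splitting and separability.\<close>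

locale root_tower = field R for R (structure) +
  fixes K :: "'a set" and f :: "'a list" and n :: nat and x :: "nat \<Rightarrow> 'a" and d :: "nat \<Rightarrow> nat"
  assumes K: "subfield K R"
    and f: "f \<in> carrier (K[X])" "f \<noteq> []" "degree f = n"
    and x: "bij_betw x {1..n} {a. is_root f a}"
    and gen: "carrier R = generate_field R (K \<union> {a. is_root f a})"
    and d: "\<And>j. j \<in> {1..n} \<Longrightarrow> d j = adjoin_degree R K x j"
begin

abbreviation tower where "tower \<equiv> adjoin_upto R K x"

lemma is_root_x: "j \<in> {1..n} \<Longrightarrow> is_root f (x j)"
  using x by (auto simp: bij_betw_def)

lemma x_closed: "j \<in> {1..n} \<Longrightarrow> x j \<in> carrier R"
  using is_root_x by (auto simp: is_root_def)

lemma card_roots: "card {a. is_root f a} = n"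
  using bij_betw_same_card[OF x] by simp

lemma tower_gens_closed: "i \<le> n \<Longrightarrow> K \<union> x ` {1..i} \<subseteq> carrier R"
  using subfieldE(3)[OF K] x_closed by auto

lemma subfield_tower: "i \<le> n \<Longrightarrow> subfield (tower i) R"
  unfolding adjoin_upto_def by (rule generate_field_is_subfield[OF tower_gens_closed])

lemma gens_subset_tower: "i \<le> n \<Longrightarrow> K \<union> x ` {1..i} \<subseteq> tower i"
  unfolding adjoin_upto_def by (rule generate_fieldE(2)[OF tower_gens_closed refl])

lemma tower_0: "tower 0 = K"
proof -
  have "generate_field R K = K"
    using generate_fieldI[OF subfieldE(3)[OF K] K] by auto
  then show ?thesis by (simp add: adjoin_upto_def)
qed

lemma tower_n: "tower n = carrier R"
  using x gen by (simp add: adjoin_upto_def bij_betw_def)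

lemma f_in_tower: "i \<le> n \<Longrightarrow> f \<in> carrier ((tower i)[X])"
  using f(1) gens_subset_tower[of i]
  by (auto simp: univ_poly_carrier[symmetric] polynomial_def)

lemma algebraic_x:
  assumes "i < n"
  shows "(algebraic over tower i) (x (Suc i))"
  using algebraicI[OF f_in_tower f(2), of i] is_root_x[of "Suc i"] assms
  by (simp add: is_root_def)

text \<open>Links the generated field to polynomial expressions in \<open>x (Suc i)\<close>: these
  already form a field because \<open>x (Suc i)\<close> is algebraic, so minimality of the generated
  field gives one inclusion; the other needs only closure under ring operations.\<close>

lemma tower_Suc:
  assumes i: "i < n"
  shows "tower (Suc i) = simple_extension (tower i) (x (Suc i))"
proof
  have T: "subfield (tower i) R" "subring (tower i) R"
    using subfield_tower[of i] subfieldE(1) i by auto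
  have xi: "x (Suc i) \<in> carrier R" using x_closed[of "Suc i"] i by simp
  let ?S = "simple_extension (tower i) (x (Suc i))"
  have "K \<union> x ` {1..Suc i} \<subseteq> ?S"
    using gens_subset_tower[of i] i simple_extension_incl[OF subringE(1)[OF T(2)] xi]
      simple_extension_mem[OF T(2) xi]
    by (auto simp: atLeastAtMostSuc_conv)
  moreover have "subfield ?S R"
    using simple_extension_is_subfield[OF T(1) xi] algebraic_x[OF i] by simp
  ultimately show "tower (Suc i) \<subseteq> ?S"
    unfolding adjoin_upto_def[of R K x "Suc i"]
    using generate_field_min_subfield1[OF tower_gens_closed] i by simp
  have sub: "subfield (tower (Suc i)) R" "K \<union> x ` {1..Suc i} \<subseteq> tower (Suc i)"
    using subfield_tower[of "Suc i"] gens_subset_tower[of "Suc i"] i by auto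
  have "tower i \<subseteq> tower (Suc i)"
    unfolding adjoin_upto_def
    using mono_generate_field[OF _ tower_gens_closed[of "Suc i"], of "K \<union> x ` {1..i}"] i
    by (auto simp: atLeastAtMostSuc_conv)
  moreover have "x (Suc i) \<in> tower (Suc i)" using sub(2) by (simp add: image_subset_iff)
  ultimately show "?S \<subseteq> tower (Suc i)"
    using simple_extension_subring_incl[OF subfieldE(1)[OF sub(1)], of "tower i"] by blast
qed

lemma Irr_x:
  assumes i: "i < n"
  shows "Irr (tower i) (x (Suc i)) \<in> carrier ((tower i)[X])"
    "Irr (tower i) (x (Suc i)) \<noteq> []"
    "Irr (tower i) (x (Suc i)) pdivides f"
    "degree (Irr (tower i) (x (Suc i))) = d (Suc i)"
    "d (Suc i) \<ge> 1"
proof -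
  have T: "subfield (tower i) R" using subfield_tower i by simp
  have xi: "x (Suc i) \<in> carrier R" using x_closed[of "Suc i"] i by simp
  note irr = IrrE[OF T xi algebraic_x[OF i]]
  show p: "Irr (tower i) (x (Suc i)) \<in> carrier ((tower i)[X])" by (rule irr)
  show ne: "Irr (tower i) (x (Suc i)) \<noteq> []"
    using pirreducibleE(1)[OF subfieldE(1)[OF T] irr(1,2)] .
  show "Irr (tower i) (x (Suc i)) pdivides f"
    using Irr_minimal[OF T xi algebraic_x[OF i] f_in_tower] i is_root_x[of "Suc i"]
    by (simp add: is_root_def)
  show deg: "degree (Irr (tower i) (x (Suc i))) = d (Suc i)"
    using d[of "Suc i"] i by (simp add: adjoin_degree_def)
  show "d (Suc i) \<ge> 1"
    using pirreducible_degree[OF T irr(1,2)] deg by simp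
qed

section \<open>Conjugates and extension to Galois automorphisms\<close>

lemma map_f:
  assumes "\<And>a. a \<in> K \<Longrightarrow> h a = a"
  shows "map h f = f"
proof -
  have "set f \<subseteq> K" using f(1) polynomial_incl univ_poly_carrier by blast
  then show ?thesis using assms by (intro map_idI) auto
qed

text \<open>The minimal polynomial divides \<open>f\<close>, and \<open>f\<close> is fixed by
  \<open>h\<close> and has \<open>n\<close> distinct zeros; a divisor then has its full number of
  zeros after transport by \<open>h\<close>.\<close>

lemma card_conjugates_ge:
  assumes i: "i < n" and h: "h \<in> ring_hom (R\<lparr>carrier := tower i\<rparr>) R" "\<And>a. a \<in> K \<Longrightarrow> h a = a"
  shows "d (Suc i) \<le> card {y \<in> carrier R. eval (map h (Irr (tower i) (x (Suc i)))) y = \<zero>}"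
proof -
  have "degree f \<le> card {a. is_root f a}" using card_roots f(3) by simp
  then show ?thesis
    using card_zeros_map_ge_degree[OF _ h(1) _ f(2) map_f[OF h(2)] _ Irr_x(1,3)]
      subfield_tower[of i] f_in_tower[of i] Irr_x(4)[OF i] i by simp
qed

text \<open>Being injective, \<open>h\<close> permutes the finitely many zeros of \<open>f\<close>.
  Its image is thus a subfield containing \<open>K\<close> and all zeros, hence everything.
  Restriction supplies the extensionality that \<open>galois_group\<close> demands.\<close>

lemma endomorphism_in_galois_group:
  assumes h: "h \<in> ring_hom R R" "\<And>a. a \<in> K \<Longrightarrow> h a = a"
  shows "restrict h (carrier R) \<in> carrier (galois_group R K)"
proof -
  interpret h: ring_hom_ring R R h
    by (intro ring_hom_ringI2 h ring_axioms)
  have inj: "inj_on h (carrier R)"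
    using non_trivial_field_hom_is_inj[OF h(1) field_axioms field_axioms] .
  let ?Z = "{a. is_root f a}"
  have Z: "?Z \<subseteq> carrier R" by (auto simp: is_root_def)
  have "set f \<subseteq> carrier R"
    using f_in_tower[of n] tower_n polynomial_incl univ_poly_carrier by blast
  then have "h ` ?Z \<subseteq> ?Z"
    using h.eval_hom'[of _ f, symmetric] map_f[of h] h(2) by (auto simp: is_root_def)
  moreover have "finite ?Z" using bij_betw_finite[OF x] by simp
  ultimately have "h ` ?Z = ?Z"
    using endo_inj_surj inj_on_subset[OF inj Z] by blast
  then have roots: "?Z \<subseteq> h ` carrier R" using Z by blast
  have "subfield (h ` carrier R) R"
    using h.img_is_subfield(2)[OF carrier_is_subfield] by simp
  moreover have "K \<subseteq> h ` carrier R" using h(2) subfieldE(3)[OF K] by force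
  ultimately have "carrier R \<subseteq> h ` carrier R"
    using gen generate_field_min_subfield1[of "K \<union> ?Z"] roots Z subfieldE(3)[OF K] by simp
  then have "bij_betw h (carrier R) (carrier R)"
    using inj h.hom_closed by (auto simp: bij_betw_def)
  then have "restrict h (carrier R) \<in> ring_iso R R"
    using h(1) by (auto simp: ring_iso_def ring_hom_def cong: bij_betw_cong)
  then show ?thesis
    using h(2) subfieldE(3)[OF K] by (auto simp: carrier_galois_group)
qed

text \<open>The tower is climbed one root at a time. The minimal polynomial of the next root,
  transported by \<open>h\<close>, has a zero to which this root can be sent; at the top
  \<open>tower n\<close> is the whole field.\<close>

lemma extends_to_galois_group:
  assumes "i \<le> n" "h \<in> ring_hom (R\<lparr>carrier := tower i\<rparr>) R" "\<And>a. a \<in> K \<Longrightarrow> h a = a"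
  shows "\<exists>\<sigma>\<in>carrier (galois_group R K). \<forall>a\<in>tower i. \<sigma> a = h a"
  using assms
proof (induct "n - i" arbitrary: i h)
  case 0
  then have "tower i = carrier R" using tower_n by simp
  then show ?case
    using endomorphism_in_galois_group[of h] 0
    by (intro bexI[of _ "restrict h (carrier R)"]) auto
next
  case (Suc m)
  then have i: "i < n" by simp
  let ?p = "Irr (tower i) (x (Suc i))"
  have T: "subfield (tower i) R" "K \<subseteq> tower i"
    using subfield_tower[of i] gens_subset_tower[of i] i by auto
  have xi: "x (Suc i) \<in> carrier R" using x_closed[of "Suc i"] i by simp
  have "card {y \<in> carrier R. eval (map h ?p) y = \<zero>} \<ge> 1"
    using card_conjugates_ge[OF i Suc.prems(2,3)] Irr_x(5)[OF i] by linarith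
  then have "{y \<in> carrier R. eval (map h ?p) y = \<zero>} \<noteq> {}" by force
  then obtain y where y: "y \<in> carrier R" "eval (map h ?p) y = \<zero>" by blast
  obtain g where g: "g \<in> ring_hom (R\<lparr>carrier := tower (Suc i)\<rparr>) R" "\<And>b. b \<in> tower i \<Longrightarrow> g b = h b"
    using ring_hom_extends_to_simple_extension[OF T(1) Suc.prems(2) xi algebraic_x[OF i] y]
    unfolding tower_Suc[OF i] by blast
  have "\<exists>\<sigma>\<in>carrier (galois_group R K). \<forall>a\<in>tower (Suc i). \<sigma> a = g a"
    using Suc.hyps(2) g T(2) Suc.prems(3) i by (intro Suc.hyps(1)) auto
  moreover have "tower i \<subseteq> tower (Suc i)"
    unfolding tower_Suc[OF i] using simple_extension_incl[OF subfieldE(3)[OF T(1)] xi] .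
  ultimately show ?case using g(2) by (metis subsetD)
qed

text \<open>The inclusion of \<open>tower i\<close> is extended first to
  \<open>tower (Suc i)\<close> by sending \<open>x (Suc i)\<close> to \<open>y\<close>, and then to
  the whole field.\<close>

lemma exists_conjugating_automorphism:
  assumes i: "i < n" and y: "y \<in> carrier R" "eval (Irr (tower i) (x (Suc i))) y = \<zero>"
  shows "\<exists>\<sigma>\<in>carrier (galois_group R K). (\<forall>a\<in>tower i. \<sigma> a = a) \<and> \<sigma> (x (Suc i)) = y"
proof -
  have T: "subfield (tower i) R" "K \<subseteq> tower i"
    using subfield_tower[of i] gens_subset_tower[of i] i by auto
  have xi: "x (Suc i) \<in> carrier R" using x_closed[of "Suc i"] i by simp
  have "id \<in> ring_hom (R\<lparr>carrier := tower i\<rparr>) R"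
    using subfieldE(3)[OF T(1)] by (auto intro!: ring_hom_memI)
  then obtain g where g: "g \<in> ring_hom (R\<lparr>carrier := tower (Suc i)\<rparr>) R"
    "\<And>b. b \<in> tower i \<Longrightarrow> g b = b" "g (x (Suc i)) = y"
    using ring_hom_extends_to_simple_extension[OF T(1) _ xi algebraic_x[OF i] y(1), of id] y(2)
    unfolding tower_Suc[OF i] by auto
  obtain \<sigma> where "\<sigma> \<in> carrier (galois_group R K)" "\<forall>a\<in>tower (Suc i). \<sigma> a = g a"
    using extends_to_galois_group[of "Suc i" g] g(1,2) T(2) i by auto
  moreover have "tower i \<subseteq> tower (Suc i)" "x (Suc i) \<in> tower (Suc i)"
    unfolding tower_Suc[OF i]
    using simple_extension_incl[OF subfieldE(3)[OF T(1)] xi]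
      simple_extension_mem[OF subfieldE(1)[OF T(1)] xi] by auto
  ultimately show ?thesis using g(2,3) by (metis subsetD)
qed

section \<open>Independence and spanning of the power products\<close>

lemma galois_groupD:
  assumes "\<sigma> \<in> carrier (galois_group R K)"
  shows "\<sigma> \<in> ring_hom R R" "inj_on \<sigma> (carrier R)" "\<And>a. a \<in> carrier R \<Longrightarrow> \<sigma> a \<in> carrier R"
    "\<And>a. a \<in> K \<Longrightarrow> \<sigma> a = a"
  using assms by (auto simp: carrier_galois_group ring_iso_def bij_betw_def ring_hom_def)

lemma compose_in_galois_group:
  assumes \<sigma>: "\<sigma> \<in> carrier (galois_group R K)" and \<tau>: "\<tau> \<in> carrier (galois_group R K)"
  shows "compose (carrier R) \<sigma> \<tau> \<in> carrier (galois_group R K)"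
proof -
  have "\<sigma> \<in> Bij (carrier R)" "\<tau> \<in> Bij (carrier R)"
    using \<sigma> \<tau> by (auto simp: carrier_galois_group ring_iso_def Bij_def)
  then show ?thesis
    using monoid.m_closed[OF group.is_monoid[OF group_galois_group[OF subfieldE(3)[OF K]]] \<sigma> \<tau>]
    by (simp add: galois_group_def BijGroup_def)
qed

text \<open>Gives uniqueness when applied to a difference of two coefficient families. The induction
  rests on having the relation for all \<sigma> at once: composing \<sigma> with automorphisms
  fixing \<open>tower i\<close> varies the last point alone, so the inner sums vanish, again for
  every \<sigma>.\<close>

lemma galois_relation_trivial:
  assumes "i \<le> n" "c \<in> exponent_range d i \<rightarrow> carrier R"
    and "\<And>\<sigma>. \<sigma> \<in> carrier (galois_group R K) \<Longrightarrow>
      (\<Oplus>k\<in>exponent_range d i. c k \<otimes> power_prod d (\<lambda>j. \<sigma> (x j)) i k) = \<zero>"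
    and "k \<in> exponent_range d i"
  shows "c k = \<zero>"
  using assms
proof (induct i arbitrary: c k)
  case 0
  \<comment> \<open>Only the empty tuple and the empty product remain, so any automorphism shows the
    claim; the identity is taken.\<close>
  have "(\<lambda>a\<in>carrier R. a) \<in> carrier (galois_group R K)"
    using monoid.one_closed[OF group.is_monoid[OF group_galois_group[OF subfieldE(3)[OF K]]]]
    by (simp add: galois_group_def BijGroup_def)
  from 0(3)[OF this] show ?case
    using 0(2,4) by (simp add: exponent_range_0 power_prod_def)
next
  case (Suc i)
  then have i: "i < n" by simp
  let ?p = "Irr (tower i) (x (Suc i))"
  let ?Y = "{y \<in> carrier R. eval ?p y = \<zero>}"
  have c: "c (k(Suc i := e)) \<in> carrier R" if "e \<in> {1..d (Suc i)}" "k \<in> exponent_range d i" for e k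
    using Suc.prems(2) that by (auto simp: exponent_range_Suc Pi_iff)
  \<comment> \<open>For fixed \<sigma>, the inner sums are the coefficients of a polynomial in the
    last variable; the zeros used are the images under \<sigma> of the zeros of
    \<open>?p\<close>.\<close>
  have inner: "(\<Oplus>k\<in>exponent_range d i. c (k(Suc i := e)) \<otimes> power_prod d (\<lambda>j. \<sigma> (x j)) i k) = \<zero>"
    if \<sigma>: "\<sigma> \<in> carrier (galois_group R K)" and e: "e \<in> {1..d (Suc i)}" for \<sigma> e
  proof (rule coeffs_eq_zero_if_many_zeros[where Y = "\<sigma> ` ?Y" and D = "d (Suc i)", OF _ _ _ _ e])
    have \<sigma>x: "(\<lambda>j. \<sigma> (x j)) \<in> {1..i} \<rightarrow> carrier R"
      using galois_groupD(3)[OF \<sigma>] x_closed i by auto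
    show "(\<lambda>e. \<Oplus>k\<in>exponent_range d i. c (k(Suc i := e)) \<otimes> power_prod d (\<lambda>j. \<sigma> (x j)) i k)
        \<in> {1..d (Suc i)} \<rightarrow> carrier R"
      using c power_prod_closed[OF \<sigma>x] by (auto intro!: finsum_closed)
    show "\<sigma> ` ?Y \<subseteq> carrier R" using galois_groupD(3)[OF \<sigma>] by auto
    have "card (\<sigma> ` ?Y) = card ?Y"
      by (rule card_image) (rule inj_on_subset[OF galois_groupD(2)[OF \<sigma>]], auto)
    moreover have "id \<in> ring_hom (R\<lparr>carrier := tower i\<rparr>) R"
      using subfieldE(3)[OF subfield_tower[of i]] i by (auto intro!: ring_hom_memI)
    then have "d (Suc i) \<le> card ?Y" using card_conjugates_ge[OF i, of id] by simp
    ultimately show "d (Suc i) \<le> card (\<sigma> ` ?Y)" by simp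
    fix z assume "z \<in> \<sigma> ` ?Y"
    then obtain y where y: "y \<in> carrier R" "eval ?p y = \<zero>" "z = \<sigma> y" by auto
    obtain \<tau> where \<tau>: "\<tau> \<in> carrier (galois_group R K)" "\<forall>a\<in>tower i. \<tau> a = a" "\<tau> (x (Suc i)) = y"
      using exists_conjugating_automorphism[OF i y(1,2)] by blast
    \<comment> \<open>This composite agrees with \<sigma> on the first \<open>i\<close> roots, which
      \<tau> fixes, and sends \<open>x (Suc i)\<close> to \<open>z\<close>; the relation for it is
      the claim at \<open>z\<close>.\<close>
    let ?\<rho> = "compose (carrier R) \<sigma> \<tau>"
    have \<rho>: "?\<rho> \<in> carrier (galois_group R K)" by (rule compose_in_galois_group[OF \<sigma> \<tau>(1)])
    have \<rho>x: "(\<lambda>j. ?\<rho> (x j)) \<in> {1..Suc i} \<rightarrow> carrier R"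
      using galois_groupD(3)[OF \<rho>] x_closed i by auto
    have \<rho>_eq: "?\<rho> (x j) = \<sigma> (x j)" if "j \<in> {1..i}" for j
      using that \<tau>(2) x_closed[of j] gens_subset_tower[of i] i
      by (simp add: compose_def image_subset_iff)
    have \<rho>_z: "?\<rho> (x (Suc i)) = z"
      using \<tau>(3) y(3) x_closed[of "Suc i"] i by (simp add: compose_def)
    have eq: "power_prod d (\<lambda>j. ?\<rho> (x j)) i k = power_prod d (\<lambda>j. \<sigma> (x j)) i k" for k
      unfolding power_prod_def by (rule finprod_cong') (use \<sigma>x \<rho>_eq in auto)
    show "(\<Oplus>e\<in>{1..d (Suc i)}. (\<Oplus>k\<in>exponent_range d i.
        c (k(Suc i := e)) \<otimes> power_prod d (\<lambda>j. \<sigma> (x j)) i k) \<otimes> z [^] (d (Suc i) - e)) = \<zero>"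
      using Suc.prems(3)[OF \<rho>] finsum_power_prod_Suc[OF \<rho>x Suc.prems(2)]
      unfolding eq \<rho>_z by (simp only:)
  qed
  obtain k' e where ke: "k' \<in> exponent_range d i" "e \<in> {1..d (Suc i)}" "k = k'(Suc i := e)"
    using Suc.prems(4) unfolding exponent_range_Suc by blast
  have "(\<lambda>k. c (k(Suc i := e))) \<in> exponent_range d i \<rightarrow> carrier R"
    using c[OF ke(2)] by auto
  from Suc.hyps[OF _ this inner[OF _ ke(2)] ke(1)] show ?case
    unfolding ke(3) using i by simp
qed

text \<open>An element of \<open>tower (Suc i)\<close> is a polynomial in \<open>x (Suc i)\<close>
  over \<open>tower i\<close>; division by the minimal polynomial brings the degree below
  \<open>d (Suc i)\<close>, and the coefficients of the remainder are expanded by induction.\<close>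

lemma tower_spanned:
  assumes "i \<le> n" "a \<in> tower i"
  shows "\<exists>c \<in> exponent_range d i \<rightarrow> K.
    a = (\<Oplus>k\<in>exponent_range d i. c k \<otimes> power_prod d x i k)"
  using assms
proof (induct i arbitrary: a)
  case 0
  then have a: "a \<in> K" "a \<in> carrier R" using tower_0 subfieldE(3)[OF K] by auto
  then show ?case
    by (intro bexI[of _ "\<lambda>_. a"]) (auto simp: exponent_range_0 power_prod_def)
next
  case (Suc i)
  then have i: "i < n" by simp
  let ?p = "Irr (tower i) (x (Suc i))"
  let ?D = "d (Suc i)"
  have T: "subfield (tower i) R" "subring (tower i) R" "tower i \<subseteq> carrier R"
    using subfield_tower[of i] subfieldE i by auto
  have xi: "x (Suc i) \<in> carrier R" using x_closed[of "Suc i"] i by simp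
  interpret E: ring_hom_ring "(tower i)[X]" R "\<lambda>p. eval p (x (Suc i))"
    using eval_ring_hom[OF T(2) xi] .
  obtain p where p: "p \<in> carrier ((tower i)[X])" "a = eval p (x (Suc i))"
    using Suc.prems(2) unfolding tower_Suc[OF i] simple_extension_as_eval_img[OF T(3) xi] by blast
  obtain q r where qr: "q \<in> carrier ((tower i)[X])" "r \<in> carrier ((tower i)[X])"
    "p = (?p \<otimes>\<^bsub>(tower i)[X]\<^esub> q) \<oplus>\<^bsub>(tower i)[X]\<^esub> r" "r = [] \<or> degree r < degree ?p"
    using field_long_division_theorem_shell[OF T(1) p(1) Irr_x(1)[OF i]] Irr_x(2)[OF i]
    by (auto simp: univ_poly_zero)
  have a: "a = eval r (x (Suc i))"
    using p(2) qr(1,2) Irr_x(1)[OF i] IrrE(4)[OF T(1) xi algebraic_x[OF i]]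
    unfolding qr(3) by simp
  have r: "set r \<subseteq> tower i" using qr(2) polynomial_incl univ_poly_carrier by blast
  have len: "length r \<le> ?D" using qr(4) Irr_x(4,5)[OF i] by (cases r) auto
  \<comment> \<open>Leading zeros pad \<open>r\<close> to exactly \<open>?D\<close> entries;
    \<open>b\<close> lists them from index 1, whence the shift \<open>e - 1\<close>.\<close>
  define s where "s = replicate (?D - length r) \<zero> @ r"
  define b where "b e = s ! (e - 1)" for e
  have s: "length s = ?D" "set s \<subseteq> tower i"
    using len r subringE(2)[OF T(2)] by (auto simp: s_def)
  have s_eq: "s = map b [1..<Suc ?D]"
    by (rule nth_equalityI) (use s(1) in \<open>auto simp: b_def simp del: upt_Suc\<close>)
  have b: "b \<in> {1..?D} \<rightarrow> tower i"
  proof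
    fix e assume "e \<in> {1..?D}"
    then have "e - 1 < length s" using s(1) by auto
    then show "b e \<in> tower i" using s(2) nth_mem unfolding b_def by blast
  qed
  have b': "b \<in> {1..?D} \<rightarrow> carrier R" using b T(3) by auto
  have a_eq: "a = (\<Oplus>e\<in>{1..?D}. b e \<otimes> x (Suc i) [^] (?D - e))"
    using a eval_replicate[of r "x (Suc i)"] r T(3) xi eval_map_upt[OF b' xi]
    unfolding s_eq[symmetric] by (simp add: s_def)
  have "\<forall>e\<in>{1..?D}. \<exists>c \<in> exponent_range d i \<rightarrow> K.
      b e = (\<Oplus>k\<in>exponent_range d i. c k \<otimes> power_prod d x i k)"
    using Suc.hyps b i by auto
  then obtain C where C: "\<And>e. e \<in> {1..?D} \<Longrightarrow> C e \<in> exponent_range d i \<rightarrow> K"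
    "\<And>e. e \<in> {1..?D} \<Longrightarrow> b e = (\<Oplus>k\<in>exponent_range d i. C e k \<otimes> power_prod d x i k)"
    by metis
  \<comment> \<open>The families \<open>C e\<close> are glued: the last entry of \<open>k\<close>
    selects the family, and resetting it to \<open>undefined\<close> recovers the shorter
    tuple.\<close>
  define c where "c k = C (k (Suc i)) (k(Suc i := undefined))" for k
  have c_upd: "c (k(Suc i := e)) = C e k" if "k \<in> exponent_range d i" for k e
  proof -
    have "k (Suc i) = undefined" using that by (auto simp: exponent_range_def PiE_def extensional_def)
    then show ?thesis by (simp add: c_def fun_upd_idem)
  qed
  have cK: "c \<in> exponent_range d (Suc i) \<rightarrow> K"
    using C(1) c_upd unfolding exponent_range_Suc by (auto simp: Pi_iff)
  then have cR: "c \<in> exponent_range d (Suc i) \<rightarrow> carrier R" using subfieldE(3)[OF K] by auto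
  have xs: "x \<in> {1..Suc i} \<rightarrow> carrier R" using x_closed i by auto
  then have xs': "x \<in> {1..i} \<rightarrow> carrier R" by auto
  have b_eq: "b e = (\<Oplus>k\<in>exponent_range d i. c (k(Suc i := e)) \<otimes> power_prod d x i k)"
    if e: "e \<in> {1..?D}" for e
    unfolding C(2)[OF e]
    by (rule add.finprod_cong')
      (use c_upd C(1)[OF e] subfieldE(3)[OF K] power_prod_closed[OF xs'] in \<open>auto simp: Pi_iff\<close>)
  have "(\<Oplus>k\<in>exponent_range d (Suc i). c k \<otimes> power_prod d x (Suc i) k)
      = (\<Oplus>e\<in>{1..?D}. b e \<otimes> x (Suc i) [^] (?D - e))"
    unfolding finsum_power_prod_Suc[OF xs cR]
    by (rule add.finprod_cong') (use b' xi b_eq in auto)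
  then show ?case using cK a_eq by (intro bexI[of _ c]) simp_all
qed

end

section \<open>Existence, uniqueness and coefficients in \<open>K\<close>\<close>

theorem theorem4:
  fixes L :: "('a, 'b) ring_scheme" (structure)
    and K :: "'a set" and f :: "'a list" and n i :: nat
    and x :: "nat \<Rightarrow> 'a" and d :: "nat \<Rightarrow> nat"
  assumes "field L" and "subfield K L"
    and "f \<in> carrier (K[X])" and "lead_coeff f = \<one>" and "pirreducible K f"
    and "degree f = n"
    and "splitting_field L K f" and "separable_in L f"
    and "bij_betw x {1..n} {a. ring.is_root L f a}"
    and "\<And>j. j \<in> {1..n} \<Longrightarrow> d j = adjoin_degree L K x j"
    and "i \<in> {1..n}"
  shows "(\<exists>!P. P \<in> ring.indexed_pset L {1..i} (carrier L) \<and>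
            (\<exists>c \<in> exponent_range d i \<rightarrow> carrier L. P = ring.cauchy_form L d i c) \<and>
            (\<forall>\<sigma> \<in> carrier (galois_group L K).
               ring.indexed_point_eval L (\<lambda>j. \<sigma> (x j)) P = \<zero>))
       \<and> (\<forall>c \<in> exponent_range d i \<rightarrow> carrier L.
            (\<forall>\<sigma> \<in> carrier (galois_group L K).
               ring.indexed_point_eval L (\<lambda>j. \<sigma> (x j)) (ring.cauchy_form L d i c) = \<zero>)
            \<longrightarrow> (\<forall>k \<in> exponent_range d i. c k \<in> K))"
proof -
  interpret field L by fact
  interpret root_tower L K f n x d
  proof (intro root_tower.intro root_tower_axioms.intro)
    \<comment> \<open>The empty list has degree 0, but \<open>n\<close> is at least 1 because it
      bounds \<open>i\<close>.\<close>
    show "f \<noteq> []" using assms(6,11) by auto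
    show "carrier L = generate_field L (K \<union> {a. is_root f a})"
      using assms(7) by (simp add: splitting_field_def)
  qed (use assms in auto)
  let ?E = "exponent_range d i"
  let ?G = "carrier (galois_group L K)"
  let ?zero = "\<lambda>c. \<forall>\<sigma>\<in>?G. indexed_point_eval (\<lambda>j. \<sigma> (x j)) (cauchy_form d i c) = \<zero>"
  have i: "i \<ge> 1" "i \<le> n" using assms(11) by auto
  have \<sigma>x: "(\<lambda>j. \<sigma> (x j)) \<in> {1..i} \<rightarrow> carrier L" if "\<sigma> \<in> ?G" for \<sigma>
    using galois_groupD(3)[OF that] x_closed i by auto
  have KL: "K \<subseteq> carrier L" using subfieldE(3)[OF K] .
  have xs: "x \<in> {1..i} \<rightarrow> carrier L" using x_closed i by auto
  have xi: "x i \<in> carrier L" using xs i by auto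
  have "x i \<in> tower i" using gens_subset_tower[OF i(2)] i by auto
  then have "x i [^] d i \<in> tower i"
  proof -
    interpret T: field "L\<lparr>carrier := tower i\<rparr>" using subfield_iff(2)[OF subfield_tower[OF i(2)]] .
    show ?thesis
      using T.nat_pow_closed[of "x i" "d i"] \<open>x i \<in> tower i\<close> by (simp add: nat_pow_consistent[symmetric])
  qed
  then have "\<ominus> (x i [^] d i) \<in> tower i"
    using subringE(5)[OF subfieldE(1)[OF subfield_tower[OF i(2)]]] by blast
  \<comment> \<open>Moving this expansion to the other side makes the normal form with coefficients
    \<open>c0\<close> vanish at the original roots.\<close>
  then obtain c0 where c0: "c0 \<in> ?E \<rightarrow> K"
    "\<ominus> (x i [^] d i) = (\<Oplus>k\<in>?E. c0 k \<otimes> power_prod d x i k)"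
    using tower_spanned[OF i(2)] by blast
  have c0L: "c0 \<in> ?E \<rightarrow> carrier L" using c0(1) KL by auto
  \<comment> \<open>Each \<sigma> fixes the coefficients \<open>c0 k\<close>, so applying it to the
    expansion gives the same relation at the conjugate point.\<close>
  have zero_c0: "?zero c0"
  proof
    fix \<sigma> assume \<sigma>: "\<sigma> \<in> ?G"
    interpret s: ring_hom_cring L L \<sigma>
      using galois_groupD(1)[OF \<sigma>] by unfold_locales
    have pw: "\<sigma> (power_prod d x i k) = power_prod d (\<lambda>j. \<sigma> (x j)) i k" for k
      unfolding power_prod_def using xs \<sigma>x[OF \<sigma>]
      by (subst s.hom_finprod) (auto intro!: finprod_cong' simp: Pi_iff)
    have "(\<Oplus>k\<in>?E. c0 k \<otimes> power_prod d (\<lambda>j. \<sigma> (x j)) i k)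
        = \<sigma> (\<Oplus>k\<in>?E. c0 k \<otimes> power_prod d x i k)"
      using c0(1) c0L power_prod_closed[OF xs] galois_groupD(4)[OF \<sigma>] power_prod_closed[OF \<sigma>x[OF \<sigma>]]
      by (subst s.hom_finsum) (auto intro!: add.finprod_cong' simp: Pi_iff pw)
    also have "\<dots> = \<ominus> (\<sigma> (x i) [^] d i)"
      unfolding c0(2)[symmetric] using xi by simp
    finally show "indexed_point_eval (\<lambda>j. \<sigma> (x j)) (cauchy_form d i c0) = \<zero>"
      using indexed_point_eval_cauchy_form[OF c0L i(1) \<sigma>x[OF \<sigma>]] xi by (simp add: r_neg)
  qed
  \<comment> \<open>The leading term is common to both forms, so subtraction leaves a relation of
    low degree with coefficients \<open>c k \<ominus> c0 k\<close>.\<close>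
  have unique: "c k = c0 k" if c: "c \<in> ?E \<rightarrow> carrier L" "?zero c" and k: "k \<in> ?E" for c k
  proof -
    have "c k \<ominus> c0 k = \<zero>"
    proof (rule galois_relation_trivial[OF i(2) _ _ k])
      show "(\<lambda>k. c k \<ominus> c0 k) \<in> ?E \<rightarrow> carrier L" using c(1) c0L by auto
      fix \<sigma> assume \<sigma>: "\<sigma> \<in> ?G"
      let ?m = "power_prod d (\<lambda>j. \<sigma> (x j)) i"
      let ?S = "\<lambda>c. \<Oplus>k\<in>?E. c k \<otimes> ?m k"
      have m: "?m k \<in> carrier L" for k by (rule power_prod_closed[OF \<sigma>x[OF \<sigma>]])
      have S: "?S c \<in> carrier L" if "c \<in> ?E \<rightarrow> carrier L" for c
        using that m by (auto intro!: finsum_closed)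
      have "?S (\<lambda>k. c k \<ominus> c0 k) \<oplus> ?S c0 = (\<Oplus>k\<in>?E. (c k \<ominus> c0 k) \<otimes> ?m k \<oplus> c0 k \<otimes> ?m k)"
        using c(1) c0L m by (intro finsum_addf[symmetric]) auto
      also have "\<dots> = ?S c"
      proof (rule add.finprod_cong')
        fix k assume "k \<in> ?E"
        then have "c k \<in> carrier L" "c0 k \<in> carrier L" using c(1) c0L by auto
        then show "(c k \<ominus> c0 k) \<otimes> ?m k \<oplus> c0 k \<otimes> ?m k = c k \<otimes> ?m k"
          using m[of k] by (simp add: l_distr[symmetric] minus_eq a_assoc l_neg)
      qed (use c(1) m in auto)
      finally have sum: "?S (\<lambda>k. c k \<ominus> c0 k) \<oplus> ?S c0 = ?S c" .
      have "\<sigma> (x i) [^] d i \<oplus> ?S c = \<zero>" "\<sigma> (x i) [^] d i \<oplus> ?S c0 = \<zero>"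
        using c(2) zero_c0 \<sigma> indexed_point_eval_cauchy_form[OF c(1) i(1) \<sigma>x[OF \<sigma>]]
          indexed_point_eval_cauchy_form[OF c0L i(1) \<sigma>x[OF \<sigma>]] by auto
      moreover have "\<sigma> (x i) [^] d i \<in> carrier L" using \<sigma>x[OF \<sigma>] i by auto
      ultimately have "?S c = ?S c0"
        using S[OF c(1)] S[OF c0L] add.l_cancel[of "\<sigma> (x i) [^] d i" "?S c" "?S c0"] by simp
      moreover have "?S (\<lambda>k. c k \<ominus> c0 k) \<in> carrier L" using c(1) c0L by (intro S) auto
      ultimately show "?S (\<lambda>k. c k \<ominus> c0 k) = \<zero>"
        using sum S[OF c0L] by (simp add: add.r_cancel_one)
    qed
    then show ?thesis using c(1) c0L k by (simp add: Pi_iff)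
  qed
  \<comment> \<open>Coefficient families are determined only on \<open>?E\<close>; the polynomial
    depends on nothing else, so uniqueness passes from coefficients to polynomials.\<close>
  have form_eq: "cauchy_form d i c = cauchy_form d i c0"
    if c: "c \<in> ?E \<rightarrow> carrier L" "?zero c" for c
  proof -
    have "(\<Oplus>k\<in>?E. indexed_monom (c k) (M k) m) = (\<Oplus>k\<in>?E. indexed_monom (c0 k) (M k) m)"
      for M :: "_ \<Rightarrow> nat multiset" and m
      using c0L unique[OF c] by (intro add.finprod_cong') (auto simp: indexed_monom_def)
    then show ?thesis by (simp add: cauchy_form_def)
  qed
  show ?thesis
  proof (intro conjI ballI impI)
    show "\<exists>!P. P \<in> indexed_pset {1..i} (carrier L) \<and>
        (\<exists>c \<in> ?E \<rightarrow> carrier L. P = cauchy_form d i c) \<and>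
        (\<forall>\<sigma>\<in>?G. indexed_point_eval (\<lambda>j. \<sigma> (x j)) P = \<zero>)"
      using cauchy_form_in_indexed_pset[OF c0L i(1)] c0L zero_c0 form_eq
      by (intro ex1I[of _ "cauchy_form d i c0"]) blast+
  next
    \<comment> \<open>Any admissible \<open>c\<close> agrees on \<open>?E\<close> with
      \<open>c0\<close>, which takes values in \<open>K\<close> there.\<close>
    fix c k assume "c \<in> ?E \<rightarrow> carrier L" "?zero c" "k \<in> ?E"
    then show "c k \<in> K" using unique[of c k] c0(1) by (simp add: Pi_iff)
  qed
qed

end
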